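(* Let $F$ be a field, let $\mathcal K$ be a finite chain complex over $F$, let $\mathbb M$ be a vital Morse construction and let $\mathbb M^\infty(\mathcal K)$ be the resulting iterated Morse complex. Then for every $i$, the Betti number $\beta_i(\mathcal K)=\dim_F H_i(\mathcal K;F)$ equals the number of $i$-dimensional cells of $\mathbb M^\infty(\mathcal K)$: $$\beta_i(\mathcal K)=\bigl|\{A\in\mathbb M^{\infty}(\mathcal K)\;:\;\dim A=i\}\bigr|.$$
   Context: **Chain complexes.** A finite chain complex $\mathcal K$ over $F$ means a finite set of cells, each with a dimension $\dim A\in\mathbb Z_{\ge 0}$, with incidence indices $\kappa(A,b)\in F$ for cells with $\dim A=\dim b+1$ (and $\kappa(A,b)=0$ for all other pairs), such that $\partial A=\sum_b\kappa(A,b)\,b$, extended linearly to the free $F$-modules on $p$-cells, satisfies $\partial\partial=0$. **Morse matchings and complexes.** A matching $M$ is a set of pairwise disjoint pairs $(A,b)$ with $\kappa(A,b)\neq0$; unmatched cells are critical. Its Morse graph is the directed graph on the cells with an edge $A\to b$ for each $\kappa(A,b)\ne0$ with $(A,b)\notin M$, and an edge $b\to A$ for each $(A,b)\in M$. $M$ is acyclic if this graph has no directed cycle. All matchings are assumed acyclic. The Morse complex of $M$ has as cells the critical cells (same dimensions), with incidence of critical $s$ and $c$, $\dim s=\dim c+1$, equal to the sum, over all directed paths $s=A_0\to a_1\to A_1\to a_2\to\dots\to a_k\to A_k\to c$ ($k\ge0$, $(A_i,a_i)\in M$ for $1\le i\le k$) in the Morse graph, of $(-1)^k\,\kappa(A_0,a_1)\prod_{i=1}^{k}\kappa(A_i,a_i)^{-1}\kappa(A_i,a_{i+1})$,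 where $a_{k+1}:=c$. (Over $\mathbb Z_2$: the number of such paths mod 2.) **Vital Morse construction.** An assignment $\mathbb M$ sending each finite chain complex to the Morse complex of some acyclic matching on it, such that (vitality) this matching is nonempty whenever there are cells $A,b$ with $\kappa(A,b)\neq0$. Nothing else is assumed about $\mathbb M$. Since each nonempty matching strictly decreases the number of cells, the sequence $\mathcal K,\mathbb M(\mathcal K),\mathbb M^2(\mathcal K),\dots$ stabilizes; the iterated Morse complex $\mathbb M^\infty(\mathcal K)$ is the stable value. *)

theory Defs
  imports "HOL-Algebra.AbelCoset" "Jordan_Normal_Form.VS_Connect"
begin

record ('a, 'f) chain_complex =
  cells :: "'a set"
  cell_dim :: "'a \<Rightarrow> nat"
  inc :: "'a \<Rightarrow> 'a \<Rightarrow> 'f"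

text \<open>
  The free module on the \<open>p\<close>-cells is rendered as the functions \<open>'a \<Rightarrow> 'f\<close> supported on
  the \<open>p\<close>-cells. The values of \<^const>\<open>cell_dim\<close> outside \<^const>\<open>cells\<close> carry no meaning.
\<close>

definition chain_space :: "('a, 'f::field) chain_complex \<Rightarrow> nat \<Rightarrow> ('a \<Rightarrow> 'f) set" where
  "chain_space K p = {x. \<forall>A. x A \<noteq> 0 \<longrightarrow> A \<in> cells K \<and> cell_dim K A = p}"

definition boundary_map :: "('a, 'f::field) chain_complex \<Rightarrow> ('a \<Rightarrow> 'f) \<Rightarrow> 'a \<Rightarrow> 'f" where
  "boundary_map K x b = (\<Sum>A\<in>cells K. x A * inc K A b)"

definition finite_chain_complex :: "('a, 'f::field) chain_complex \<Rightarrow> bool" where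
  "finite_chain_complex K \<longleftrightarrow>
     finite (cells K) \<and>
     (\<forall>A b. inc K A b \<noteq> 0 \<longrightarrow>
        A \<in> cells K \<and> b \<in> cells K \<and> cell_dim K A = cell_dim K b + 1) \<and>
     (\<forall>p. \<forall>x\<in>chain_space K p. boundary_map K (boundary_map K x) = (\<lambda>_. 0))"

definition chain_module ::
    "('a, 'f::field) chain_complex \<Rightarrow> nat \<Rightarrow> ('f, 'a \<Rightarrow> 'f) module" where
  "chain_module K p =
     \<lparr> carrier = chain_space K p, mult = undefined, one = undefined,
       zero = (\<lambda>_. 0), add = (\<lambda>x y A. x A + y A), smult = (\<lambda>k x A. k * x A) \<rparr>"

text \<open>
  In degree \<open>0\<close> the incidence condition makes the boundary of every chain vanish, so all
  \<open>0\<close>-chains are cycles.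
\<close>

definition cycles :: "('a, 'f::field) chain_complex \<Rightarrow> nat \<Rightarrow> ('a \<Rightarrow> 'f) set" where
  "cycles K p = {x \<in> chain_space K p. boundary_map K x = (\<lambda>_. 0)}"

definition boundaries :: "('a, 'f::field) chain_complex \<Rightarrow> nat \<Rightarrow> ('a \<Rightarrow> 'f) set" where
  "boundaries K p = boundary_map K ` chain_space K (p + 1)"

text \<open>
  The quotient \<open>V/W\<close> on the additive cosets. The scalar multiple of a coset is
  \<open>k (W + x) = W + k x\<close>; taking cosets of the multiples is needed when \<open>k = 0\<close>.
\<close>

definition quotient_module :: "('f, 'v) module \<Rightarrow> 'v set \<Rightarrow> ('f, 'v set) module" where
  "quotient_module V W =
     \<lparr> carrier = a_rcosets\<^bsub>V\<^esub> W, mult = undefined, one = undefined,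
       zero = W, add = (\<lambda>X Y. X <+>\<^bsub>V\<^esub> Y),
       smult = (\<lambda>k X. \<Union>x\<in>X. W +>\<^bsub>V\<^esub> (k \<odot>\<^bsub>V\<^esub> x)) \<rparr>"

definition homology ::
    "('a, 'f::field) chain_complex \<Rightarrow> nat \<Rightarrow> ('f, ('a \<Rightarrow> 'f) set) module" where
  "homology K p = quotient_module ((chain_module K p)\<lparr>carrier := cycles K p\<rparr>) (boundaries K p)"

definition betti :: "('a, 'f::field) chain_complex \<Rightarrow> nat \<Rightarrow> nat" where
  "betti K p = vectorspace.dim class_ring (homology K p)"

definition matching :: "('a, 'f::field) chain_complex \<Rightarrow> ('a \<times> 'a) set \<Rightarrow> bool" where
  "matching K M \<longleftrightarrow>
     (\<forall>(A, b)\<in>M. inc K A b \<noteq> 0) \<and>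
     (\<forall>(A, b)\<in>M. \<forall>(A', b')\<in>M. (A, b) \<noteq> (A', b') \<longrightarrow> {A, b} \<inter> {A', b'} = {})"

definition critical :: "('a, 'f::field) chain_complex \<Rightarrow> ('a \<times> 'a) set \<Rightarrow> 'a set" where
  "critical K M = {c \<in> cells K. \<forall>(A, b)\<in>M. c \<noteq> A \<and> c \<noteq> b}"

definition morse_graph :: "('a, 'f::field) chain_complex \<Rightarrow> ('a \<times> 'a) set \<Rightarrow> ('a \<times> 'a) set" where
  "morse_graph K M = {(A, b). inc K A b \<noteq> 0 \<and> (A, b) \<notin> M} \<union> {(b, A). (A, b) \<in> M}"

definition acyclic_matching :: "('a, 'f::field) chain_complex \<Rightarrow> ('a \<times> 'a) set \<Rightarrow> bool" where
  "acyclic_matching K M \<longleftrightarrow> matching K M \<and> acyclic (morse_graph K M)"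

text \<open>
  A path \<open>s = A\<^sub>0 \<rightarrow> a\<^sub>1 \<rightarrow> A\<^sub>1 \<rightarrow> \<dots> \<rightarrow> a\<^sub>k \<rightarrow> A\<^sub>k \<rightarrow> c\<close> is encoded by the list
  \<open>ps = [(A\<^sub>1, a\<^sub>1), \<dots>, (A\<^sub>k, a\<^sub>k)]\<close> of the matched pairs it runs through. Then
  \<open>path_top s ps ! i\<close> is \<open>A\<^sub>i\<close>, whereas \<open>path_bot ps c ! i\<close> is \<open>a\<^sub>i\<^sub>+\<^sub>1\<close>, with last entry \<open>c\<close>.
  The edges \<open>a\<^sub>i \<rightarrow> A\<^sub>i\<close> are in the Morse graph because \<open>(A\<^sub>i, a\<^sub>i) \<in> M\<close>.
\<close>

definition path_top :: "'a \<Rightarrow> ('a \<times> 'a) list \<Rightarrow> 'a list" where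
  "path_top s ps = s # map fst ps"

definition path_bot :: "('a \<times> 'a) list \<Rightarrow> 'a \<Rightarrow> 'a list" where
  "path_bot ps c = map snd ps @ [c]"

definition morse_paths ::
    "('a, 'f::field) chain_complex \<Rightarrow> ('a \<times> 'a) set \<Rightarrow> 'a \<Rightarrow> 'a \<Rightarrow> ('a \<times> 'a) list set" where
  "morse_paths K M s c =
     {ps. set ps \<subseteq> M \<and>
          (\<forall>i\<le>length ps. (path_top s ps ! i, path_bot ps c ! i) \<in> morse_graph K M)}"

definition path_weight ::
    "('a, 'f::field) chain_complex \<Rightarrow> 'a \<Rightarrow> 'a \<Rightarrow> ('a \<times> 'a) list \<Rightarrow> 'f" where
  "path_weight K s c ps =
     (- 1) ^ length ps * inc K s (path_bot ps c ! 0) *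
     (\<Prod>i\<in>{1..length ps}.
        inverse (inc K (path_top s ps ! i) (path_bot ps c ! (i - 1))) *
        inc K (path_top s ps ! i) (path_bot ps c ! i))"

text \<open>
  For an acyclic matching on a finite complex the set of paths is finite, so the sum is the
  intended one.
\<close>

definition morse_complex ::
    "('a, 'f::field) chain_complex \<Rightarrow> ('a \<times> 'a) set \<Rightarrow> ('a, 'f) chain_complex" where
  "morse_complex K M =
     \<lparr> cells = critical K M, cell_dim = cell_dim K,
       inc = (\<lambda>s c. if s \<in> critical K M \<and> c \<in> critical K M \<and> cell_dim K s = cell_dim K c + 1
                    then \<Sum>ps\<in>morse_paths K M s c. path_weight K s c ps else 0) \<rparr>"

definition vital_morse_construction ::
    "(('a, 'f::field) chain_complex \<Rightarrow> ('a, 'f) chain_complex) \<Rightarrow> bool" where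
  "vital_morse_construction \<M> \<longleftrightarrow>
     (\<forall>K. finite_chain_complex K \<longrightarrow>
        (\<exists>M. acyclic_matching K M \<and> \<M> K = morse_complex K M \<and>
             ((\<exists>A b. inc K A b \<noteq> 0) \<longrightarrow> M \<noteq> {})))"

definition iterated_morse_complex ::
    "(('a, 'f::field) chain_complex \<Rightarrow> ('a, 'f) chain_complex) \<Rightarrow>
      ('a, 'f) chain_complex \<Rightarrow> ('a, 'f) chain_complex" where
  "iterated_morse_complex \<M> K = (THE L. \<exists>N. \<forall>n\<ge>N. (\<M> ^^ n) K = L)"

end

theory Submission
  imports Defs
begin

text \<open>
  Split the cells of a complex with an acyclic matching \<open>M\<close> into upper cells, lower cells and
  critical cells. Acyclicity makes the part of the boundary map from upper to lower cells
  triangular, hence invertible, so every critical chain \<open>x\<close> has a unique correction \<open>lift x\<close> by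
  upper cells whose boundary contains no lower cell; solving the triangular system expresses
  it by sums over paths of the Morse graph. The boundary of the Morse complex is the critical
  part of \<open>\<partial> (lift x)\<close>, and \<open>lift\<close> is an injective chain map onto the chains \<open>y\<close> such that
  neither \<open>y\<close> nor \<open>\<partial> y\<close> involves a lower cell. Since each cycle can be moved into this
  subcomplex by subtracting the boundary of an upper chain, \<open>lift\<close> is an isomorphism on homology.
  By vitality the iteration only stops at a complex with zero boundary map.
\<close>

section \<open>Chains and homology\<close>

definition linear_op :: "(('a \<Rightarrow> 'f::field) \<Rightarrow> 'b \<Rightarrow> 'f) \<Rightarrow> bool" where
  "linear_op G \<longleftrightarrow> (\<forall>x y k. G (\<lambda>A. x A + k * y A) = (\<lambda>A. G x A + k * G y A))"

lemma linear_opD: "linear_op G \<Longrightarrow> G (\<lambda>A. x A + k * y A) = (\<lambda>A. G x A + k * G y A)"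
  by (simp add: linear_op_def)

lemma linear_op_add: "linear_op G \<Longrightarrow> G (\<lambda>A. x A + y A) = (\<lambda>A. G x A + G y A)"
  using linear_opD[of G x 1 y] by simp

lemma linear_op_diff: "linear_op G \<Longrightarrow> G (\<lambda>A. x A - y A) = (\<lambda>A. G x A - G y A)"
  using linear_opD[of G x "-1" y] by simp

lemma linear_op_zero: "linear_op G \<Longrightarrow> G (\<lambda>_. 0) = (\<lambda>_. 0)"
  using linear_op_diff[of G "\<lambda>_. 0" "\<lambda>_. 0"] by simp

lemma linear_op_scale: "linear_op G \<Longrightarrow> G (\<lambda>A. k * x A) = (\<lambda>A. k * G x A)"
  using linear_opD[of G "\<lambda>_. 0" k x] by (simp add: linear_op_zero)

lemma linear_op_sum:
  assumes "linear_op G" "finite I"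
  shows "G (\<lambda>A. \<Sum>i\<in>I. k i * x i A) = (\<lambda>A. \<Sum>i\<in>I. k i * G (x i) A)"
  using assms(2)
proof induction
  case empty
  then show ?case using linear_op_zero[OF assms(1)] by simp
next
  case (insert i I)
  then show ?case
    using linear_opD[OF assms(1), of "\<lambda>A. \<Sum>i\<in>I. k i * x i A" "k i" "x i"]
    by (simp add: add.commute)
qed

lemma linear_op_boundary_map: "linear_op (boundary_map K)"
  by (simp add: linear_op_def boundary_map_def fun_eq_iff distrib_right sum.distrib
      sum_distrib_left mult.assoc)

definition linear_subspace :: "('a \<Rightarrow> 'f::field) set \<Rightarrow> bool" where
  "linear_subspace W \<longleftrightarrow> (\<lambda>_. 0) \<in> W \<and> (\<forall>x\<in>W. \<forall>y\<in>W. \<forall>k. (\<lambda>A. x A + k * y A) \<in> W)"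

lemma linear_subspaceD:
  assumes "linear_subspace W"
  shows "(\<lambda>_. 0) \<in> W"
    and "x \<in> W \<Longrightarrow> y \<in> W \<Longrightarrow> (\<lambda>A. x A + k * y A) \<in> W"
    and "x \<in> W \<Longrightarrow> y \<in> W \<Longrightarrow> (\<lambda>A. x A + y A) \<in> W"
    and "x \<in> W \<Longrightarrow> y \<in> W \<Longrightarrow> (\<lambda>A. x A - y A) \<in> W"
    and "x \<in> W \<Longrightarrow> (\<lambda>A. k * x A) \<in> W"
proof -
  have *: "(\<lambda>A. x A + k * y A) \<in> W" if "x \<in> W" "y \<in> W" for x y k
    using assms that by (simp add: linear_subspace_def)
  show z: "(\<lambda>_. 0) \<in> W" using assms by (simp add: linear_subspace_def)
  show "x \<in> W \<Longrightarrow> y \<in> W \<Longrightarrow> (\<lambda>A. x A + k * y A) \<in> W"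
    and "x \<in> W \<Longrightarrow> y \<in> W \<Longrightarrow> (\<lambda>A. x A + y A) \<in> W"
    and "x \<in> W \<Longrightarrow> y \<in> W \<Longrightarrow> (\<lambda>A. x A - y A) \<in> W"
    and "x \<in> W \<Longrightarrow> (\<lambda>A. k * x A) \<in> W"
    using *[of x y k] *[of x y 1] *[of x y "-1"] *[OF z, of x k] by simp_all
qed

lemma linear_subspace_image:
  assumes "linear_op G" "linear_subspace W"
  shows "linear_subspace (G ` W)"
  unfolding linear_subspace_def
proof (intro conjI ballI allI)
  show "(\<lambda>_. 0) \<in> G ` W"
    using linear_op_zero[OF assms(1)] linear_subspaceD(1)[OF assms(2)] by (metis imageI)
  show "(\<lambda>A. x A + k * y A) \<in> G ` W" if "x \<in> G ` W" "y \<in> G ` W" for x y k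
    using that linear_subspaceD(2)[OF assms(2)]
    by (auto simp: linear_opD[OF assms(1), symmetric])
qed

lemma linear_subspace_chain_space: "linear_subspace (chain_space K p)"
  by (simp add: linear_subspace_def chain_space_def) (metis add.right_neutral mult_zero_right)

lemma chain_spaceI:
  assumes "\<And>A. \<not> (A \<in> cells K \<and> cell_dim K A = p) \<Longrightarrow> x A = 0"
  shows "x \<in> chain_space K p"
  unfolding chain_space_def using assms by blast

lemma linear_subspace_cycles: "linear_subspace (cycles K p)"
  using linear_subspaceD[OF linear_subspace_chain_space]
  by (auto simp: linear_subspace_def cycles_def linear_op_zero[OF linear_op_boundary_map]
       linear_opD[OF linear_op_boundary_map])

lemma linear_subspace_boundaries: "linear_subspace (boundaries K p)"
  unfolding boundaries_def
  by (intro linear_subspace_image linear_op_boundary_map linear_subspace_chain_space)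

lemma boundary_map_chain_space:
  assumes "finite_chain_complex K" "x \<in> chain_space K (p + 1)"
  shows "boundary_map K x \<in> chain_space K p"
  unfolding chain_space_def
proof (clarify)
  fix b assume "boundary_map K x b \<noteq> 0"
  then obtain A where "x A \<noteq> 0" "inc K A b \<noteq> 0"
    unfolding boundary_map_def by (metis (no_types, lifting) mult_eq_0_iff sum.neutral)
  with assms show "b \<in> cells K \<and> cell_dim K b = p"
    by (fastforce simp: finite_chain_complex_def chain_space_def)
qed

lemma boundary_boundary:
  assumes "finite_chain_complex K" "x \<in> chain_space K p"
  shows "boundary_map K (boundary_map K x) = (\<lambda>_. 0)"
  using assms by (simp add: finite_chain_complex_def)

lemma boundaries_subset_cycles:
  assumes "finite_chain_complex K"
  shows "boundaries K p \<subseteq> cycles K p"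
  using boundary_map_chain_space[OF assms] boundary_boundary[OF assms]
  by (auto simp: boundaries_def cycles_def)

section \<open>Homology in terms of representatives\<close>

definition hclass :: "('a, 'f::field) chain_complex \<Rightarrow> nat \<Rightarrow> ('a \<Rightarrow> 'f) \<Rightarrow> ('a \<Rightarrow> 'f) set" where
  "hclass K p x = {y. (\<lambda>A. y A - x A) \<in> boundaries K p}"

lemma hclass_eq_iff: "hclass K p x = hclass K p y \<longleftrightarrow> (\<lambda>A. x A - y A) \<in> boundaries K p"
proof
  note B = linear_subspaceD[OF linear_subspace_boundaries]
  have "x \<in> hclass K p x" using B(1) by (simp add: hclass_def)
  then show "hclass K p x = hclass K p y \<Longrightarrow> (\<lambda>A. x A - y A) \<in> boundaries K p"
    by (auto simp: hclass_def)
  assume xy: "(\<lambda>A. x A - y A) \<in> boundaries K p"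
  have "(\<lambda>A. z A - x A) \<in> boundaries K p \<longleftrightarrow> (\<lambda>A. z A - y A) \<in> boundaries K p" for z
    using B(3)[OF _ xy, where x = "\<lambda>A. z A - x A"] B(4)[OF _ xy, where x = "\<lambda>A. z A - y A"] by auto
  then show "hclass K p x = hclass K p y" by (auto simp: hclass_def)
qed

text \<open>This is the form to which \<open>a_r_coset_def'\<close> unfolds; it links classes
  described by differences to the cosets in \<open>quotient_module\<close>.\<close>

lemma hclass_eq_coset:
  "hclass K p x = (\<Union>b\<in>boundaries K p. {\<lambda>A. b A + x A})"
proof (intro Set.set_eqI iffI)
  fix y assume "y \<in> hclass K p x"
  then have "(\<lambda>A. y A - x A) \<in> boundaries K p" by (simp add: hclass_def)
  then show "y \<in> (\<Union>b\<in>boundaries K p. {\<lambda>A. b A + x A})"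
    by (intro UN_I[of "\<lambda>A. y A - x A"]) auto
qed (auto simp: hclass_def)

lemma homology_carrier: "carrier (homology K p) = hclass K p ` cycles K p"
  by (auto simp: homology_def quotient_module_def A_RCOSETS_def' hclass_eq_coset
      a_r_coset_def' chain_module_def)

lemma homology_zero: "\<zero>\<^bsub>homology K p\<^esub> = hclass K p (\<lambda>_. 0)"
  by (simp add: homology_def quotient_module_def hclass_def)

text \<open>Boundaries are closed under addition, so elementwise sums stay in the class of
  \<open>x + y\<close>; conversely any \<open>z\<close> in that class splits as
  \<open>(z - y) + y\<close>.\<close>

lemma homology_add:
  "hclass K p x \<oplus>\<^bsub>homology K p\<^esub> hclass K p y = hclass K p (\<lambda>A. x A + y A)"
proof -
  note B = linear_subspaceD[OF linear_subspace_boundaries]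
  have "hclass K p x \<oplus>\<^bsub>homology K p\<^esub> hclass K p y =
     (\<Union>u\<in>hclass K p x. \<Union>v\<in>hclass K p y. {\<lambda>A. u A + v A})"
    by (simp add: homology_def quotient_module_def set_add_def' chain_module_def)
  also have "\<dots> = hclass K p (\<lambda>A. x A + y A)"
  proof (intro Set.set_eqI iffI)
    fix z assume "z \<in> (\<Union>u\<in>hclass K p x. \<Union>v\<in>hclass K p y. {\<lambda>A. u A + v A})"
    then obtain u v where z: "z = (\<lambda>A. u A + v A)" and "u \<in> hclass K p x" "v \<in> hclass K p y"
      by auto
    then show "z \<in> hclass K p (\<lambda>A. x A + y A)"
      using B(3)[where x = "\<lambda>A. u A - x A" and y = "\<lambda>A. v A - y A"] by (simp add: hclass_def algebra_simps)
  next
    fix z assume z: "z \<in> hclass K p (\<lambda>A. x A + y A)"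
    have "(\<lambda>A. z A - y A) \<in> hclass K p x" "y \<in> hclass K p y"
      using z B(1) by (simp_all add: hclass_def algebra_simps)
    moreover have "z = (\<lambda>A. (z A - y A) + y A)" by simp
    ultimately show "z \<in> (\<Union>u\<in>hclass K p x. \<Union>v\<in>hclass K p y. {\<lambda>A. u A + v A})" by blast
  qed
  finally show ?thesis .
qed

text \<open>If \<open>y - x\<close> is a boundary, so is \<open>k * (y - x)\<close>: all cosets in
  the union that defines the scalar multiple coincide, and the union is not empty because
  \<open>x\<close> lies in its own class.\<close>

lemma homology_smult:
  "k \<odot>\<^bsub>homology K p\<^esub> hclass K p x = hclass K p (\<lambda>A. k * x A)"
proof -
  note B = linear_subspaceD[OF linear_subspace_boundaries]
  have "k \<odot>\<^bsub>homology K p\<^esub> hclass K p x = (\<Union>y\<in>hclass K p x. hclass K p (\<lambda>A. k * y A))"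
    by (simp add: homology_def quotient_module_def hclass_eq_coset a_r_coset_def' chain_module_def)
  also have "\<dots> = (\<Union>y\<in>hclass K p x. hclass K p (\<lambda>A. k * x A))"
  proof (rule Sup.SUP_cong[OF refl])
    fix y assume "y \<in> hclass K p x"
    then have "(\<lambda>A. k * (y A - x A)) \<in> boundaries K p"
      using B(5) by (auto simp: hclass_def)
    then show "hclass K p (\<lambda>A. k * y A) = hclass K p (\<lambda>A. k * x A)"
      by (simp add: hclass_eq_iff algebra_simps)
  qed
  also have "\<dots> = hclass K p (\<lambda>A. k * x A)"
  proof -
    have "x \<in> hclass K p x" using B(1) by (simp add: hclass_def)
    then show ?thesis by auto
  qed
  finally show ?thesis .
qed

lemma vectorspace_homology: "vectorspace class_ring (homology K p)"
proof -
  note Z = linear_subspaceD[OF linear_subspace_cycles]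
  show ?thesis
    apply (rule vs_criteria)
    subgoal by (rule class_field)
    subgoal using Z(1) by (auto simp: homology_carrier homology_zero intro!: imageI)
    subgoal using Z(3) by (auto simp: homology_carrier homology_add intro!: imageI)
    subgoal
    proof
      fix v assume "v \<in> carrier (homology K p)"
      then obtain x where x: "x \<in> cycles K p" "v = hclass K p x"
        by (auto simp: homology_carrier)
      with Z(5)[where x = x and k = "-1"] show "\<exists>w\<in>carrier (homology K p). v \<oplus>\<^bsub>homology K p\<^esub> w = \<zero>\<^bsub>homology K p\<^esub>"
        by (intro bexI[of _ "hclass K p (\<lambda>A. - x A)"])
          (auto simp: homology_carrier homology_zero homology_add)
    qed
    subgoal using Z(5) by (auto simp: homology_carrier homology_smult intro!: imageI)
    by (auto simp: homology_carrier homology_add homology_smult homology_zero algebra_simps)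
qed

section \<open>Maps that induce isomorphisms on homology\<close>

text \<open>
  A linear map inducing isomorphisms on homology. Only its effect on cycles matters, so it is
  not required to commute with the boundary maps.
\<close>

definition quasi_iso ::
    "(('a \<Rightarrow> 'f) \<Rightarrow> 'a \<Rightarrow> 'f) \<Rightarrow> ('a, 'f::field) chain_complex \<Rightarrow> ('a, 'f) chain_complex \<Rightarrow> bool" where
  "quasi_iso G L K \<longleftrightarrow> linear_op G \<and>
     (\<forall>p. (\<forall>x\<in>cycles L p. G x \<in> cycles K p) \<and>
          (\<forall>z\<in>cycles K p. \<exists>x\<in>cycles L p. (\<lambda>A. z A - G x A) \<in> boundaries K p) \<and>
          (\<forall>x\<in>cycles L p. G x \<in> boundaries K p \<longleftrightarrow> x \<in> boundaries L p))"

lemma quasi_iso_id: "quasi_iso (\<lambda>x. x) K K"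
  using linear_subspaceD(1)[OF linear_subspace_boundaries]
  by (auto simp: quasi_iso_def linear_op_def intro!: bexI)

lemma quasi_iso_comp:
  assumes F: "quasi_iso F J L" and G: "quasi_iso G L K" and L: "finite_chain_complex L"
  shows "quasi_iso (\<lambda>x. G (F x)) J K"
  unfolding quasi_iso_def
proof (intro conjI allI ballI)
  have lF: "linear_op F" and lG: "linear_op G" using F G by (auto simp: quasi_iso_def)
  then show "linear_op (\<lambda>x. G (F x))" by (simp add: linear_op_def)
  fix p
  show "G (F x) \<in> cycles K p" if "x \<in> cycles J p" for x
    using that F G by (auto simp: quasi_iso_def)
  show "G (F x) \<in> boundaries K p \<longleftrightarrow> x \<in> boundaries J p" if "x \<in> cycles J p" for x
    using that F G by (auto simp: quasi_iso_def)
  fix z assume "z \<in> cycles K p"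
  then obtain y where y: "y \<in> cycles L p" "(\<lambda>A. z A - G y A) \<in> boundaries K p"
    using G unfolding quasi_iso_def by blast
  then obtain x where x: "x \<in> cycles J p" "(\<lambda>A. y A - F x A) \<in> boundaries L p"
    using F unfolding quasi_iso_def by blast
  \<comment> \<open>\<open>quasi_iso\<close> transports boundaries only among cycles; the boundary
    \<open>y - F x\<close> is a cycle because \<open>L\<close> is a chain complex.\<close>
  then have "G (\<lambda>A. y A - F x A) \<in> boundaries K p"
    using G boundaries_subset_cycles[OF L, of p] unfolding quasi_iso_def by blast
  from linear_subspaceD(3)[OF linear_subspace_boundaries y(2) this]
  have "(\<lambda>A. z A - G (F x) A) \<in> boundaries K p"
    by (simp add: linear_op_diff[OF lG])
  with x show "\<exists>x\<in>cycles J p. (\<lambda>A. z A - G (F x) A) \<in> boundaries K p" by blast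
qed

text \<open>Without incidences every \<open>p\<close>-chain of \<open>L\<close> is a cycle and only
  zero is a boundary, so the \<open>p\<close>-cells form a basis of the homology of
  \<open>L\<close>. Composing the coordinate map of this basis with \<open>G\<close> gives an
  isomorphism from coordinate vectors to the homology of \<open>K\<close>.\<close>

lemma betti_eq_card_cells:
  fixes K L :: "('a, 'f::field) chain_complex"
  assumes G: "quasi_iso G L K" and fin: "finite (cells L)" and inc0: "\<And>A b. inc L A b = 0"
  shows "betti K p = card {A \<in> cells L. cell_dim L A = p}"
proof -
  define I where "I = {A \<in> cells L. cell_dim L A = p}"
  have lG: "linear_op G" using G by (simp add: quasi_iso_def)
  have "finite I" using fin by (simp add: I_def)
  then obtain h where h: "bij_betw h I {0..<card I}"
    using ex_bij_betw_finite_nat by blast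
  have d0: "boundary_map L x = (\<lambda>_. 0)" for x
    by (simp add: boundary_map_def inc0 fun_eq_iff)
  have Z: "cycles L p = {x. \<forall>A. x A \<noteq> 0 \<longrightarrow> A \<in> I}"
    by (auto simp: cycles_def d0 chain_space_def I_def)
  have B: "boundaries L p = {\<lambda>_. 0}"
    using linear_subspaceD(1)[OF linear_subspace_boundaries]
    by (auto simp: boundaries_def d0)
  \<comment> \<open>\<open>S\<close> turns a coordinate vector into a chain through the enumeration
    \<open>h\<close> of the \<open>p\<close>-cells; \<open>T\<close> takes the homology class of its
    image under \<open>G\<close>.\<close>
  define S :: "'f Matrix.vec \<Rightarrow> 'a \<Rightarrow> 'f" where "S v = (\<lambda>A. if A \<in> I then v $ h A else 0)" for v
  define T where "T v = hclass K p (G (S v))" for v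
  have hI: "h A < card I" if "A \<in> I" for A
    using h that by (auto simp: bij_betw_def)
  have SZ: "S v \<in> cycles L p" for v by (simp add: Z S_def)
  let ?V = "module_vec TYPE('f) (card I)" and ?H = "homology K p"
  have hom: "T \<in> LinearCombinations.module_hom class_ring ?V ?H"
  proof (unfold LinearCombinations.module_hom_def, intro CollectI conjI allI impI)
    show "T \<in> carrier (?V) \<rightarrow> carrier (homology K p)"
      using G SZ by (auto simp: T_def homology_carrier quasi_iso_def)
  next
    fix u v assume "u \<in> carrier (?V) \<and> v \<in> carrier (?V)"
    then have "S (u + v) = (\<lambda>A. S u A + S v A)"
      by (auto simp: S_def module_vec_simps hI fun_eq_iff)
    then show "T (u \<oplus>\<^bsub>?V\<^esub> v) = T u \<oplus>\<^bsub>homology K p\<^esub> T v"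
      by (simp add: T_def homology_add module_vec_simps linear_op_add[OF lG])
  next
    fix k :: 'f and v assume "k \<in> carrier class_ring \<and> v \<in> carrier (?V)"
    then have "S (k \<cdot>\<^sub>v v) = (\<lambda>A. k * S v A)"
      by (auto simp: S_def module_vec_simps hI fun_eq_iff)
    then show "T (k \<odot>\<^bsub>?V\<^esub> v) = k \<odot>\<^bsub>homology K p\<^esub> T v"
      by (simp add: T_def homology_smult module_vec_simps linear_op_scale[OF lG])
  qed
  have inj: "inj_on T (carrier (?V))"
  proof (rule inj_onI)
    fix u v assume uv: "u \<in> carrier (?V)"
        "v \<in> carrier (?V)" and "T u = T v"
    then have "G (\<lambda>A. S u A - S v A) \<in> boundaries K p"
      by (simp add: T_def hclass_eq_iff linear_op_diff[OF lG])
    moreover have "(\<lambda>A. S u A - S v A) \<in> cycles L p"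
      using SZ linear_subspaceD(4)[OF linear_subspace_cycles] by blast
    ultimately have "(\<lambda>A. S u A - S v A) \<in> boundaries L p"
      using G by (simp add: quasi_iso_def)
    then have *: "S u A = S v A" for A by (simp add: B fun_eq_iff)
    show "u = v"
    proof (rule eq_vecI)
      fix i assume "i < dim_vec v"
      then have "i \<in> h ` I" using uv h by (auto simp: module_vec_simps bij_betw_def)
      then obtain A where "A \<in> I" "i = h A" by blast
      then show "u $ i = v $ i" using *[of A] by (simp add: S_def)
    qed (use uv in \<open>auto simp: module_vec_simps\<close>)
  qed
  have surj: "T ` carrier (?V) = carrier (homology K p)"
  proof
    show "T ` carrier (?V) \<subseteq> carrier (homology K p)"
      using G SZ by (auto simp: T_def homology_carrier quasi_iso_def)
    show "carrier (homology K p) \<subseteq> T ` carrier (?V)"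
    proof
      fix w assume "w \<in> carrier (homology K p)"
      then obtain z where z: "z \<in> cycles K p" "w = hclass K p z"
        by (auto simp: homology_carrier)
      then obtain x where x: "x \<in> cycles L p" "(\<lambda>A. z A - G x A) \<in> boundaries K p"
        using G unfolding quasi_iso_def by blast
      define v where "v = Matrix.vec (card I) (\<lambda>i. x (the_inv_into I h i))"
      have "S v = x"
        using x(1) h hI by (auto simp: S_def v_def Z bij_betw_def the_inv_into_f_f fun_eq_iff)
      then have "w = T v" using z x by (simp add: T_def hclass_eq_iff)
      moreover have "v \<in> carrier (?V)"
        by (simp add: v_def module_vec_simps)
      ultimately show "w \<in> T ` carrier (?V)" by blast
    qed
  qed
  have V: "vectorspace class_ring ?V" by (rule vec_vs)
  have lm: "linear_map class_ring ?V ?H T"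
    using V vectorspace_homology[of K p] hom
    by (simp add: linear_map_def mod_hom_def mod_hom_axioms_def vectorspace_def)
  show ?thesis
    using linear_map.dim_eq[OF lm vec_space.fin_dim inj surj] vec_space.dim_is_n[where 'a = 'f]
    by (simp add: betti_def I_def)
qed

section \<open>The Morse complex of an acyclic matching\<close>

locale morse =
  fixes K :: "('a, 'f::field) chain_complex" and M :: "('a \<times> 'a) set"
  assumes K: "finite_chain_complex K" and M: "acyclic_matching K M"
begin

abbreviation "C \<equiv> critical K M"
abbreviation "G \<equiv> morse_graph K M"

lemma finite_cells: "finite (cells K)"
  using K by (simp add: finite_chain_complex_def)

lemma incD:
  assumes "inc K A b \<noteq> 0"
  shows "A \<in> cells K" "b \<in> cells K" "cell_dim K A = cell_dim K b + 1"
  using assms K by (auto simp: finite_chain_complex_def)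

lemma matched_inc: "(A, b) \<in> M \<Longrightarrow> inc K A b \<noteq> 0"
  using M by (auto simp: acyclic_matching_def matching_def)

lemma matched_unique:
  assumes "(A, b) \<in> M" "(A', b') \<in> M" "{A, b} \<inter> {A', b'} \<noteq> {}"
  shows "A = A'" "b = b'"
proof -
  have "\<forall>p\<in>M. \<forall>q\<in>M. p \<noteq> q \<longrightarrow> {fst p, snd p} \<inter> {fst q, snd q} = {}"
    using M unfolding acyclic_matching_def matching_def case_prod_beta prod.collapse by (elim conjE)
  from this[rule_format, OF assms(1,2)] have "(A, b) = (A', b')"
    using assms(3) by (simp only: fst_conv snd_conv) blast
  then show "A = A'" "b = b'" by simp_all
qed

text \<open>A cell in both roles would force the two pairs to coincide, hence \<open>A = b\<close>,
  although their dimensions differ by one. Thus upper, lower and critical cells are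
  disjoint.\<close>

lemma upper_not_lower:
  assumes "(A, b) \<in> M"
  shows "(B, A) \<notin> M"
proof
  assume "(B, A) \<in> M"
  then have "b = A" by (rule matched_unique(2)[OF assms]) simp
  then show False using incD(3)[OF matched_inc[OF assms]] by simp
qed

lemma M_subset: "M \<subseteq> cells K \<times> cells K"
  using incD matched_inc by fast

lemma finite_M: "finite M"
  using M_subset finite_cells by (meson finite_SigmaI finite_subset)

lemma finite_C: "finite C"
  using finite_cells by (simp add: critical_def)

lemma C_subset: "C \<subseteq> cells K"
  by (auto simp: critical_def)

lemma criticalI:
  "A \<in> cells K \<Longrightarrow> A \<notin> fst ` M \<Longrightarrow> A \<notin> snd ` M \<Longrightarrow> A \<in> C"
  by (force simp: critical_def)

text \<open>Upward edges start only at lower cells, and an upper cell is not lower.\<close>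

lemma edge_upper: "(A, a) \<in> M \<Longrightarrow> (A, t) \<in> G \<longleftrightarrow> inc K A t \<noteq> 0 \<and> (A, t) \<notin> M"
  using upper_not_lower by (auto simp: morse_graph_def)

lemma edge_matched: "(A, a) \<in> M \<Longrightarrow> (a, A) \<in> G"
  by (simp add: morse_graph_def)

lemma edge_critical: "s \<in> C \<Longrightarrow> (s, t) \<in> G \<longleftrightarrow> inc K s t \<noteq> 0"
  by (auto simp: morse_graph_def critical_def)

lemma acyclic_G: "acyclic G"
  using M by (simp add: acyclic_matching_def)

lemma finite_G: "finite G"
proof (rule finite_subset)
  show "G \<subseteq> cells K \<times> cells K"
    using incD M_subset by (auto simp: morse_graph_def)
qed (simp add: finite_cells)

text \<open>Both directions serve as inductions: \<open>wf_G\<close> shows uniqueness for the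
  triangular system from upper to lower cells, \<open>wf_G_converse\<close> shows existence.\<close>

lemma wf_G: "wf (G\<^sup>+)" and wf_G_converse: "wf ((G\<inverse>)\<^sup>+)"
  using finite_G acyclic_G
  by (simp_all add: finite_acyclic_wf finite_acyclic_wf_converse wf_trancl)

section \<open>Paths of the Morse graph and their weights\<close>

lemma morse_paths_Nil: "[] \<in> morse_paths K M s t \<longleftrightarrow> (s, t) \<in> G"
  by (simp add: morse_paths_def path_top_def path_bot_def)

text \<open>Without its last pair \<open>m\<close>, a path to \<open>t\<close> becomes a path to the
  lower cell \<open>snd m\<close>. Recursion therefore runs over the end of the path while the start
  \<open>s\<close> stays fixed.\<close>

lemma morse_paths_snoc:
  "ps @ [m] \<in> morse_paths K M s t \<longleftrightarrow>
     ps \<in> morse_paths K M s (snd m) \<and> m \<in> M \<and> (fst m, t) \<in> G"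
proof -
  have "path_top s (ps @ [m]) = path_top s ps @ [fst m]"
    and "path_bot (ps @ [m]) t = path_bot ps (snd m) @ [t]"
    and "length (path_top s ps) = Suc (length ps)"
    and "length (path_bot ps (snd m)) = Suc (length ps)"
    by (simp_all add: path_top_def path_bot_def)
  then show ?thesis
    by (auto simp: morse_paths_def nth_append le_Suc_eq split: if_splits)
qed

lemma path_weight_Nil: "path_weight K s t [] = inc K s t"
  by (simp add: path_weight_def path_bot_def)

lemma path_weight_snoc:
  "path_weight K s t (ps @ [m]) =
     - (path_weight K s (snd m) ps * inverse (inc K (fst m) (snd m)) * inc K (fst m) t)"
proof -
  have top: "path_top s (ps @ [m]) = path_top s ps @ [fst m]"
    and bot: "path_bot (ps @ [m]) t = path_bot ps (snd m) @ [t]"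
    and len: "length (path_top s ps) = Suc (length ps)"
      "length (path_bot ps (snd m)) = Suc (length ps)"
    by (simp_all add: path_top_def path_bot_def)
  \<comment> \<open>The new factor, at index \<open>length ps + 1\<close>, reads its lower cell at
    position \<open>length ps\<close>, which is \<open>snd m\<close>.\<close>
  have last: "path_bot ps (snd m) ! length ps = snd m"
    by (simp add: path_bot_def nth_append)
  have "(\<Prod>i\<in>{1..length ps}.
        inverse (inc K (path_top s (ps @ [m]) ! i) (path_bot (ps @ [m]) t ! (i - 1))) *
        inc K (path_top s (ps @ [m]) ! i) (path_bot (ps @ [m]) t ! i)) =
     (\<Prod>i\<in>{1..length ps}.
        inverse (inc K (path_top s ps ! i) (path_bot ps (snd m) ! (i - 1))) *
        inc K (path_top s ps ! i) (path_bot ps (snd m) ! i))"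
  proof (intro prod.cong refl)
    fix i assume "i \<in> {1..length ps}"
    then have "i < Suc (length ps)" "i - 1 < Suc (length ps)" by auto
    then show "inverse (inc K (path_top s (ps @ [m]) ! i) (path_bot (ps @ [m]) t ! (i - 1))) *
        inc K (path_top s (ps @ [m]) ! i) (path_bot (ps @ [m]) t ! i) =
        inverse (inc K (path_top s ps ! i) (path_bot ps (snd m) ! (i - 1))) *
        inc K (path_top s ps ! i) (path_bot ps (snd m) ! i)"
      by (simp only: top bot len nth_append if_True)
  qed
  then show ?thesis
    by (simp add: path_weight_def prod.cl_ivl_Suc last) (simp add: top bot len nth_append last)
qed

text \<open>Every lower cell on a path reaches the end of the path by at least one edge, so a
  repeated pair would close a cycle. Distinctness bounds the paths by the finitely many distinct
  lists over \<open>M\<close>.\<close>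

lemma morse_paths_descend:
  assumes "ps \<in> morse_paths K M s t"
  shows "distinct ps" "\<forall>m\<in>set ps. (snd m, t) \<in> G\<^sup>+"
  using assms
proof (induction ps arbitrary: t rule: rev_induct)
  case Nil
  { case 1 show ?case by simp }
  { case 2 show ?case by simp }
next
  case (snoc m ps)
  { case 1
    then have "ps \<in> morse_paths K M s (snd m)" by (simp add: morse_paths_snoc)
    with snoc.IH[OF this] acyclic_G show ?case by (auto simp: acyclic_def) }
  { case 2
    then have "ps \<in> morse_paths K M s (snd m)" and m: "m \<in> M" "(fst m, t) \<in> G"
      by (simp_all add: morse_paths_snoc)
    moreover have "(snd m, t) \<in> G\<^sup>+"
      using m edge_matched[of "fst m" "snd m"] by (auto intro: trancl_into_trancl)
    ultimately show ?case using snoc.IH(2)[of "snd m"] by (auto intro: trancl_trans) }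
qed

lemma finite_morse_paths: "finite (morse_paths K M s t)"
proof (rule finite_subset)
  show "morse_paths K M s t \<subseteq> {ps. set ps \<subseteq> M \<and> distinct ps}"
    using morse_paths_descend(1) by (auto simp: morse_paths_def)
qed (simp add: finite_subset_distinct finite_M)

section \<open>Sums over paths and their recursion\<close>

text \<open>For critical \<open>s\<close> and \<open>t\<close> this is the incidence in the Morse
  complex; at a lower cell \<open>t\<close> it determines the coefficients of
  \<open>lift\<close>.\<close>

definition flow :: "'a \<Rightarrow> 'a \<Rightarrow> 'f" where
  "flow s t = (\<Sum>ps\<in>morse_paths K M s t. path_weight K s t ps)"

text \<open>If \<open>m\<close> is in \<open>M\<close> and \<open>fst m\<close> has an edge to
  \<open>t\<close>, this is minus the total weight of the paths from \<open>s\<close> to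
  \<open>t\<close> with last pair \<open>m\<close>. The formula also makes sense without that
  edge.\<close>

definition step :: "'a \<Rightarrow> 'a \<times> 'a \<Rightarrow> 'a \<Rightarrow> 'f" where
  "step s m t = flow s (snd m) * inverse (inc K (fst m) (snd m)) * inc K (fst m) t"

text \<open>The paths are sorted by their last matched pair; the first summand belongs to the path
  without any pair.\<close>

lemma flow_rec:
  "flow s t = (if (s, t) \<in> G then inc K s t else 0) - (\<Sum>m | m \<in> M \<and> (fst m, t) \<in> G. step s m t)"
proof -
  let ?N = "if (s, t) \<in> G then {[]} else {}"
  let ?M = "{m \<in> M. (fst m, t) \<in> G}"
  let ?S = "SIGMA m:?M. morse_paths K M s (snd m)"
  let ?f = "\<lambda>(m, ps). ps @ [m]"
  have split: "morse_paths K M s t = ?N \<union> ?f ` ?S"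
  proof (rule Set.set_eqI)
    fix ps
    show "ps \<in> morse_paths K M s t \<longleftrightarrow> ps \<in> ?N \<union> ?f ` ?S"
      by (cases ps rule: rev_cases) (auto simp: morse_paths_Nil morse_paths_snoc image_iff)
  qed
  have "flow s t = (\<Sum>ps\<in>?N. path_weight K s t ps) + (\<Sum>ps\<in>?f ` ?S. path_weight K s t ps)"
    unfolding flow_def split
  proof (rule sum.union_disjoint)
    show "finite (?f ` ?S)"
      by (intro finite_imageI finite_SigmaI) (simp_all add: finite_M finite_morse_paths)
  qed auto
  also have "(\<Sum>ps\<in>?f ` ?S. path_weight K s t ps) = (\<Sum>(m, ps)\<in>?S. path_weight K s t (ps @ [m]))"
    by (subst sum.reindex) (auto simp: inj_on_def case_prod_beta)
  also have "\<dots> = (\<Sum>m\<in>?M. \<Sum>ps\<in>morse_paths K M s (snd m). path_weight K s t (ps @ [m]))"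
    by (subst sum.Sigma) (simp_all add: finite_M finite_morse_paths)
  also have "\<dots> = - (\<Sum>m\<in>?M. step s m t)"
    by (simp add: path_weight_snoc step_def flow_def sum_negf sum_distrib_right)
  finally show ?thesis by (simp add: path_weight_Nil)
qed

text \<open>
  For \<open>t\<close> matched with \<open>B\<close>, the pair \<open>(B, t)\<close> is excluded from the recursion for \<open>flow s t\<close>,
  and the term it contributes to the full sum over \<open>M\<close> is \<open>flow s t\<close> itself.
\<close>

lemma flow_critical:
  assumes s: "s \<in> C"
  shows "inc K s t - (\<Sum>m\<in>M. step s m t) = (if t \<in> snd ` M then 0 else flow s t)"
proof (cases "t \<in> snd ` M")
  case True
  then obtain B where B: "(B, t) \<in> M" by auto
  have inc: "(if (s, t) \<in> G then inc K s t else 0) = inc K s t"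
    using edge_critical[OF s] by simp
  have "(\<Sum>m\<in>M. step s m t) = step s (B, t) t + (\<Sum>m\<in>M - {(B, t)}. step s m t)"
    using B finite_M by (simp add: sum.remove)
  also have "step s (B, t) t = flow s t"
    using matched_inc[OF B] by (simp add: step_def)
  also have "(\<Sum>m\<in>M - {(B, t)}. step s m t) = (\<Sum>m | m \<in> M \<and> (fst m, t) \<in> G. step s m t)"
  proof (rule sum.mono_neutral_right)
    show "{m \<in> M. (fst m, t) \<in> G} \<subseteq> M - {(B, t)}"
      using edge_upper[OF B, of t] B by auto
    show "\<forall>m\<in>M - {(B, t)} - {m \<in> M. (fst m, t) \<in> G}. step s m t = 0"
    proof
      fix m assume m: "m \<in> M - {(B, t)} - {m \<in> M. (fst m, t) \<in> G}"
      \<comment> \<open>If \<open>(fst m, t)\<close> were matched, it would equal \<open>m\<close>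
        by the shared upper cell and \<open>(B, t)\<close> by the shared lower cell, but
        \<open>m\<close> differs from \<open>(B, t)\<close>. A missing edge then means zero
        incidence.\<close>
      then have "(fst m, t) \<notin> M"
        using matched_unique[of "fst m" t B t] matched_unique(2)[of "fst m" "snd m" "fst m" t] B by force
      then show "step s m t = 0"
        using m edge_upper[of "fst m" "snd m" t] by (auto simp: step_def)
    qed
  qed (simp add: finite_M)
  finally show ?thesis
    using True flow_rec[of s t] inc by simp
next
  case False
  have inc: "(if (s, t) \<in> G then inc K s t else 0) = inc K s t"
    using edge_critical[OF s] by simp
  have "(\<Sum>m\<in>M. step s m t) = (\<Sum>m | m \<in> M \<and> (fst m, t) \<in> G. step s m t)"
  proof (rule sum.mono_neutral_right)
    show "\<forall>m\<in>M - {m \<in> M. (fst m, t) \<in> G}. step s m t = 0"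
    proof
      fix m assume m: "m \<in> M - {m \<in> M. (fst m, t) \<in> G}"
      have "(fst m, t) \<notin> M" using False by force
      then show "step s m t = 0"
        using m edge_upper[of "fst m" "snd m" t] by (auto simp: step_def)
    qed
  qed (auto simp: finite_M)
  then show ?thesis
    using False flow_rec[of s t] inc by simp
qed

text \<open>Going up along a matched pair and down again preserves the dimension, so a path drops by
  one in total. Hence the dimension test in \<open>morse_complex\<close> discards no nonzero path
  sum.\<close>

lemma flow_dim:
  assumes "s \<in> C" "flow s t \<noteq> 0"
  shows "cell_dim K s = cell_dim K t + 1" "t \<in> cells K"
proof -
  have *: "cell_dim K s = cell_dim K t + 1 \<and> t \<in> cells K" if "ps \<in> morse_paths K M s t" for ps
    using that
  proof (induction ps arbitrary: t rule: rev_induct)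
    case Nil
    then have "inc K s t \<noteq> 0" using edge_critical[OF assms(1)] by (simp add: morse_paths_Nil)
    then show ?case using incD by simp
  next
    case (snoc m ps)
    then have m: "m \<in> M" "(fst m, t) \<in> G" and "ps \<in> morse_paths K M s (snd m)"
      by (simp_all add: morse_paths_snoc)
    with snoc.IH have "cell_dim K s = cell_dim K (snd m) + 1" by simp
    moreover have "inc K (fst m) t \<noteq> 0" using m edge_upper[of "fst m" "snd m" t] by simp
    moreover have "inc K (fst m) (snd m) \<noteq> 0" using m matched_inc by simp
    ultimately show ?case using incD[of "fst m" "snd m"] incD[of "fst m" t] by simp
  qed
  have "morse_paths K M s t \<noteq> {}" using assms(2) by (auto simp: flow_def)
  then show "cell_dim K s = cell_dim K t + 1" "t \<in> cells K" using * by auto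
qed

section \<open>Lifting critical chains\<close>

text \<open>The multiple of \<open>fst m\<close> that is subtracted in \<open>lift x\<close> to
  cancel what flows from \<open>x\<close> into the lower cell \<open>snd m\<close>.\<close>

definition upper_coeff :: "('a \<Rightarrow> 'f) \<Rightarrow> 'a \<times> 'a \<Rightarrow> 'f" where
  "upper_coeff x m = (\<Sum>s\<in>C. x s * flow s (snd m)) * inverse (inc K (fst m) (snd m))"

text \<open>An upper cell lies in a single pair, so at most one summand survives; the sum form makes
  linearity and exchange of summation immediate.\<close>

definition lift :: "('a \<Rightarrow> 'f) \<Rightarrow> 'a \<Rightarrow> 'f" where
  "lift x A = (if A \<in> C then x A else 0) - (\<Sum>m\<in>M. if fst m = A then upper_coeff x m else 0)"

lemma linear_op_lift: "linear_op lift"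
proof -
  have coeff: "upper_coeff (\<lambda>A. x A + k * y A) m = upper_coeff x m + k * upper_coeff y m" for x y k m
    by (simp add: upper_coeff_def distrib_right sum.distrib sum_distrib_left mult.assoc)
  have "(\<Sum>m\<in>M. if fst m = B then upper_coeff (\<lambda>A. x A + k * y A) m else 0) =
      (\<Sum>m\<in>M. if fst m = B then upper_coeff x m else 0) +
      k * (\<Sum>m\<in>M. if fst m = B then upper_coeff y m else 0)" for x y k B
    unfolding sum_distrib_left sum.distrib[symmetric] by (intro sum.cong refl) (simp add: coeff)
  then have "lift (\<lambda>A. x A + k * y A) B = lift x B + k * lift y B" for x y k B
    unfolding lift_def by (simp add: algebra_simps)
  then show ?thesis by (simp add: linear_op_def fun_eq_iff)
qed

lemma lift_critical: "A \<in> C \<Longrightarrow> lift x A = x A"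
  by (auto simp: lift_def critical_def intro!: sum.neutral)

lemma lift_outside:
  assumes "A \<notin> C" "A \<notin> fst ` M"
  shows "lift x A = 0"
proof -
  have "fst m \<noteq> A" if "m \<in> M" for m using that assms(2) by blast
  then show ?thesis using assms(1) by (simp add: lift_def)
qed

lemma lift_lower: "A \<in> snd ` M \<Longrightarrow> lift x A = 0"
  using upper_not_lower by (intro lift_outside) (auto simp: critical_def)

text \<open>By linearity each critical \<open>s\<close> contributes the left side of
  \<open>flow_critical\<close>: the correction cancels all lower cells and leaves path sums
  elsewhere.\<close>

lemma boundary_lift:
  "boundary_map K (lift x) t = (if t \<in> snd ` M then 0 else \<Sum>s\<in>C. x s * flow s t)"
proof -
  have "boundary_map K (lift x) t = (\<Sum>A\<in>cells K. (if A \<in> C then x A * inc K A t else 0)) -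
      (\<Sum>A\<in>cells K. \<Sum>m\<in>M. if fst m = A then upper_coeff x m * inc K A t else 0)"
    unfolding boundary_map_def lift_def left_diff_distrib sum_subtractf sum_distrib_right
    by (simp add: if_distrib[of "\<lambda>u. u * _"] cong: if_cong)
  also have "(\<Sum>A\<in>cells K. (if A \<in> C then x A * inc K A t else 0)) = (\<Sum>s\<in>C. x s * inc K s t)"
    using C_subset finite_cells by (simp add: sum.inter_restrict[symmetric] Int_absorb1)
  also have "(\<Sum>A\<in>cells K. \<Sum>m\<in>M. if fst m = A then upper_coeff x m * inc K A t else 0) =
      (\<Sum>m\<in>M. \<Sum>A\<in>cells K. if fst m = A then upper_coeff x m * inc K A t else 0)"
    by (rule sum.swap)
  also have "\<dots> = (\<Sum>m\<in>M. upper_coeff x m * inc K (fst m) t)"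
    using M_subset by (intro sum.cong refl) (auto simp: finite_cells sum.delta')
  also have "\<dots> = (\<Sum>m\<in>M. \<Sum>s\<in>C. x s * step s m t)"
    by (simp add: upper_coeff_def step_def sum_distrib_right mult.assoc)
  also have "\<dots> = (\<Sum>s\<in>C. \<Sum>m\<in>M. x s * step s m t)" by (rule sum.swap)
  also have "(\<Sum>s\<in>C. x s * inc K s t) - \<dots> = (\<Sum>s\<in>C. x s * (inc K s t - (\<Sum>m\<in>M. step s m t)))"
    by (simp add: right_diff_distrib sum_subtractf sum_distrib_left)
  also have "\<dots> = (\<Sum>s\<in>C. x s * (if t \<in> snd ` M then 0 else flow s t))"
    by (intro sum.cong refl) (simp add: flow_critical)
  finally show ?thesis by simp
qed

definition crit_part :: "('a \<Rightarrow> 'f) \<Rightarrow> 'a \<Rightarrow> 'f" where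
  "crit_part y A = (if A \<in> C then y A else 0)"

abbreviation "K' \<equiv> morse_complex K M"

lemma chain_space_morse: "x \<in> chain_space K' p \<longleftrightarrow> (\<forall>A. x A \<noteq> 0 \<longrightarrow> A \<in> C \<and> cell_dim K A = p)"
  by (simp add: chain_space_def morse_complex_def)

text \<open>At a critical cell \<open>boundary_lift\<close> leaves exactly the path sums that define
  the incidences of \<open>K'\<close>.\<close>

lemma boundary_morse: "boundary_map K' x = crit_part (boundary_map K (lift x))"
proof
  fix c
  have "inc K' s c = flow s c" if "s \<in> C" "c \<in> C" for s
    using that flow_dim[of s c] by (auto simp: morse_complex_def flow_def)
  moreover have "inc K' s c = 0" if "c \<notin> C" for s
    using that by (simp add: morse_complex_def)
  moreover have "c \<notin> snd ` M" if "c \<in> C" using that by (auto simp: critical_def)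
  moreover have "cells K' = C" by (simp add: morse_complex_def)
  ultimately show "boundary_map K' x c = crit_part (boundary_map K (lift x)) c"
    unfolding crit_part_def boundary_lift by (auto simp: boundary_map_def)
qed

text \<open>An upper cell \<open>fst m\<close> occurs only if some \<open>s\<close> of dimension
  \<open>p\<close> flows into \<open>snd m\<close>, which then lies one dimension below
  \<open>p\<close>.\<close>

lemma lift_chain_space:
  assumes "x \<in> chain_space K' p"
  shows "lift x \<in> chain_space K p"
  unfolding chain_space_def
proof (clarify)
  fix A assume A: "lift x A \<noteq> 0"
  show "A \<in> cells K \<and> cell_dim K A = p"
  proof (cases "A \<in> C")
    case True
    then show ?thesis using A assms C_subset by (auto simp: lift_critical chain_space_morse)
  next
    case False
    with A have "(\<Sum>m\<in>M. if fst m = A then upper_coeff x m else 0) \<noteq> 0"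
      by (simp add: lift_def)
    then obtain m where m: "m \<in> M" "fst m = A" and "upper_coeff x m \<noteq> 0"
      by (auto elim!: sum.not_neutral_contains_not_neutral split: if_splits)
    then have "(\<Sum>s\<in>C. x s * flow s (snd m)) \<noteq> 0" by (auto simp: upper_coeff_def)
    then obtain s where s: "s \<in> C" "x s \<noteq> 0" "flow s (snd m) \<noteq> 0"
      by (auto elim!: sum.not_neutral_contains_not_neutral)
    then have "cell_dim K s = cell_dim K (snd m) + 1" using flow_dim by blast
    moreover have "cell_dim K s = p" using assms s by (simp add: chain_space_morse)
    moreover have "inc K A (snd m) \<noteq> 0" using matched_inc m by auto
    ultimately show ?thesis using incD[of A "snd m"] by simp
  qed
qed

section \<open>The triangular system from upper to lower cells\<close>

text \<open>
  If \<open>A\<close> is matched with \<open>a\<close>, the only cells of \<open>w\<close> besides \<open>A\<close> with \<open>a\<close> in their boundary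
  precede \<open>A\<close> in the Morse graph; so \<open>w A\<close> vanishes by induction along the graph.
\<close>

lemma upper_chain_zero:
  assumes supp: "\<And>A. w A \<noteq> 0 \<Longrightarrow> A \<in> fst ` M"
    and bd: "\<And>b. b \<in> snd ` M \<Longrightarrow> boundary_map K w b = 0"
  shows "w = (\<lambda>_. 0)"
proof
  fix A
  show "w A = 0"
    using wf_G
  proof (induction A rule: wf_induct_rule)
    case (less A)
    show ?case
    proof (rule ccontr)
      assume wA: "w A \<noteq> 0"
      then obtain a where a: "(A, a) \<in> M" using supp[OF wA] by auto
      have "\<forall>B\<in>cells K - {A}. w B * inc K B a = 0"
      proof (rule ballI, rule ccontr)
        fix B assume that: "B \<in> cells K - {A}"
        assume B: "w B * inc K B a \<noteq> 0"
        then obtain b where b: "(B, b) \<in> M" using supp[of B] by auto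
        have "(B, a) \<notin> M" using matched_unique(1)[of B a A a] a that by auto
        then have "(B, a) \<in> G" using edge_upper[OF b] B by simp
        then have "(B, A) \<in> G\<^sup>+" using edge_matched[OF a] by auto
        with less B show False by simp
      qed
      then have "(\<Sum>B\<in>cells K - {A}. w B * inc K B a) = 0"
        by (rule sum.neutral)
      then have "boundary_map K w a = w A * inc K A a"
        using sum.remove[OF finite_cells incD(1)[OF matched_inc[OF a]], of "\<lambda>B. w B * inc K B a"]
        by (simp add: boundary_map_def)
      moreover have "a \<in> snd ` M" using a by force
      ultimately show False using wA bd[of a] matched_inc[OF a] by simp
    qed
  qed
qed

text \<open>Back substitution: besides \<open>b\<close>, the boundary of its partner
  \<open>B\<close> meets only lower cells \<open>b'\<close> that come after \<open>b\<close> in the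
  Morse graph, via \<open>B\<close>, and for these preimages are known by induction.\<close>

lemma upper_preimage_indicator:
  assumes "b \<in> snd ` M"
  shows "\<exists>u \<in> chain_space K (cell_dim K b + 1).
    \<forall>b'\<in>snd ` M. boundary_map K u b' = (if b' = b then 1 else 0)"
  using wf_G_converse assms
proof (induction b rule: wf_induct_rule)
  case (less b)
  then obtain B where B: "(B, b) \<in> M" by auto
  let ?L = "{b' \<in> snd ` M. b' \<noteq> b \<and> inc K B b' \<noteq> 0}"
  have "\<exists>u \<in> chain_space K (cell_dim K b + 1).
    \<forall>b''\<in>snd ` M. boundary_map K u b'' = (if b'' = b' then 1 else 0)" if b': "b' \<in> ?L" for b'
  proof -
    have "(B, b') \<notin> M" using matched_unique(2)[of B b' B b] B b' by auto
    then have "(B, b') \<in> G" using edge_upper[OF B] b' by simp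
    then have "(b, b') \<in> G\<^sup>+" using edge_matched[OF B] by auto
    then have "(b', b) \<in> (G\<inverse>)\<^sup>+" by (simp add: trancl_converse)
    moreover have "cell_dim K b' = cell_dim K b"
      using b' incD(3)[OF matched_inc[OF B]] incD(3)[of B b'] by simp
    ultimately show ?thesis using less.IH[of b'] b' by simp
  qed
  then have "\<forall>b'\<in>?L. \<exists>u. u \<in> chain_space K (cell_dim K b + 1) \<and>
    (\<forall>b''\<in>snd ` M. boundary_map K u b'' = (if b'' = b' then 1 else 0))" by blast
  from bchoice[OF this] obtain u where u: "\<And>b'. b' \<in> ?L \<Longrightarrow> u b' \<in> chain_space K (cell_dim K b + 1)"
    "\<And>b' b''. b' \<in> ?L \<Longrightarrow> b'' \<in> snd ` M \<Longrightarrow> boundary_map K (u b') b'' = (if b'' = b' then 1 else 0)"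
    by blast
  have fin: "finite ?L" using finite_M by simp
  \<comment> \<open>\<open>?e\<close> is the single cell \<open>B\<close>; subtracting the preimages
    of the other lower cells in its boundary leaves \<open>b\<close> with coefficient
    \<open>inc K B b\<close>, which \<open>?k\<close> normalizes.\<close>
  let ?e = "\<lambda>A. if A = B then 1 else 0 :: 'f"
  let ?k = "inverse (inc K B b)"
  let ?v = "\<lambda>A. ?k * (?e A - (\<Sum>b'\<in>?L. inc K B b' * u b' A))"
  have B_cell: "B \<in> cells K" "cell_dim K B = cell_dim K b + 1" using incD matched_inc[OF B] by auto
  have e: "boundary_map K ?e b' = inc K B b'" for b'
    unfolding boundary_map_def using B_cell finite_cells
    by (simp add: if_distrib[of "\<lambda>u. u * _"] cong: if_cong)
  have bd: "boundary_map K ?v b'' = ?k * (inc K B b'' - (\<Sum>b'\<in>?L. inc K B b' * boundary_map K (u b') b''))" for b''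
    by (simp only: linear_op_scale[OF linear_op_boundary_map] linear_op_diff[OF linear_op_boundary_map]
        linear_op_sum[OF linear_op_boundary_map fin] e)
  have "boundary_map K ?v b'' = (if b'' = b then 1 else 0)" if b'': "b'' \<in> snd ` M" for b''
  proof -
    have "(\<Sum>b'\<in>?L. inc K B b' * boundary_map K (u b') b'') = (\<Sum>b'\<in>?L. if b'' = b' then inc K B b' else 0)"
      by (intro sum.cong refl) (use u(2) b'' in auto)
    also have "\<dots> = (if b'' \<in> ?L then inc K B b'' else 0)" using fin by (simp add: sum.delta)
    finally show ?thesis using b'' matched_inc[OF B] unfolding bd by auto
  qed
  moreover have "?v \<in> chain_space K (cell_dim K b + 1)"
  proof -
    have "?v A = 0" if "\<not> (A \<in> cells K \<and> cell_dim K A = cell_dim K b + 1)" for A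
    proof -
      have "u b' A = 0" if "b' \<in> ?L" for b'
        using u(1)[OF that] \<open>\<not> _\<close> by (auto simp: chain_space_def)
      then show ?thesis using that B_cell by auto
    qed
    then show ?thesis by (rule chain_spaceI)
  qed
  ultimately show ?case by blast
qed

lemma upper_preimage:
  assumes y: "y \<in> chain_space K p"
  shows "\<exists>u \<in> chain_space K (p + 1). \<forall>b\<in>snd ` M. boundary_map K u b = y b"
proof -
  obtain u where u: "\<And>b. b \<in> snd ` M \<Longrightarrow> u b \<in> chain_space K (cell_dim K b + 1)"
    "\<And>b b'. b \<in> snd ` M \<Longrightarrow> b' \<in> snd ` M \<Longrightarrow> boundary_map K (u b) b' = (if b' = b then 1 else 0)"
    using bchoice[of "snd ` M" "\<lambda>b u. u \<in> chain_space K (cell_dim K b + 1) \<and>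
      (\<forall>b'\<in>snd ` M. boundary_map K u b' = (if b' = b then 1 else 0))"] upper_preimage_indicator
    by blast
  have fin: "finite (snd ` M)" using finite_M by simp
  \<comment> \<open>The sum includes lower cells of every dimension, but \<open>y b\<close> vanishes
    unless \<open>b\<close> has dimension \<open>p\<close>, so the sum is a chain of degree
    \<open>p + 1\<close>.\<close>
  let ?v = "\<lambda>A. \<Sum>b\<in>snd ` M. y b * u b A"
  have "boundary_map K ?v b' = y b'" if b': "b' \<in> snd ` M" for b'
  proof -
    have "boundary_map K ?v b' = (\<Sum>b\<in>snd ` M. y b * boundary_map K (u b) b')"
      by (simp only: linear_op_sum[OF linear_op_boundary_map fin])
    also have "\<dots> = (\<Sum>b\<in>snd ` M. if b' = b then y b else 0)"
      by (intro sum.cong refl) (use u(2) b' in auto)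
    also have "\<dots> = y b'" using fin b' by (simp add: sum.delta)
    finally show ?thesis .
  qed
  moreover have "?v \<in> chain_space K (p + 1)"
  proof -
    have "?v A = 0" if A: "\<not> (A \<in> cells K \<and> cell_dim K A = p + 1)" for A
    proof (rule sum.neutral, rule ballI)
      fix b assume b: "b \<in> snd ` M"
      show "y b * u b A = 0"
        using u(1)[OF b] y A by (cases "y b = 0") (auto simp: chain_space_def)
    qed
    then show ?thesis by (rule chain_spaceI)
  qed
  ultimately show ?thesis by blast
qed

section \<open>The lift as an isomorphism on homology\<close>

text \<open>The difference of both sides is supported on upper cells and its boundary avoids lower
  cells, so \<open>upper_chain_zero\<close> applies.\<close>

lemma lift_crit_part:
  assumes "y \<in> chain_space K p"
    and "\<And>b. b \<in> snd ` M \<Longrightarrow> y b = 0" "\<And>b. b \<in> snd ` M \<Longrightarrow> boundary_map K y b = 0"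
  shows "y = lift (crit_part y)"
proof -
  let ?w = "\<lambda>A. y A - lift (crit_part y) A"
  have "?w = (\<lambda>_. 0)"
  proof (rule upper_chain_zero)
    fix A assume A: "?w A \<noteq> 0"
    then have "A \<notin> C" by (auto simp: lift_critical crit_part_def)
    moreover have "A \<notin> snd ` M"
    proof
      assume "A \<in> snd ` M"
      with A assms(2)[OF this] lift_lower[OF this] show False by simp
    qed
    moreover have "y A \<noteq> 0 \<or> A \<in> fst ` M" using A lift_outside[OF \<open>A \<notin> C\<close>] by force
    moreover have "y A \<noteq> 0 \<Longrightarrow> A \<in> cells K" using assms(1) by (simp add: chain_space_def)
    ultimately show "A \<in> fst ` M" using criticalI by blast
  next
    fix b assume "b \<in> snd ` M"
    then show "boundary_map K ?w b = 0"
      using assms(3) by (simp add: linear_op_diff[OF linear_op_boundary_map] boundary_lift)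
  qed
  then show ?thesis by (auto simp: fun_eq_iff)
qed

lemma crit_part_chain_space: "y \<in> chain_space K p \<Longrightarrow> crit_part y \<in> chain_space K' p"
  unfolding chain_space_morse by (auto simp: crit_part_def chain_space_def)

lemma crit_part_lift:
  assumes "x \<in> chain_space K' p"
  shows "crit_part (lift x) = x"
proof
  show "crit_part (lift x) A = x A" for A
    using assms by (auto simp: crit_part_def lift_critical chain_space_morse)
qed

text \<open>In degree zero there is no lower degree, but the boundary vanishes and lies in every
  chain space.\<close>

lemma chain_space_boundary_shift:
  assumes "x \<in> chain_space K p"
  shows "\<exists>q. boundary_map K x \<in> chain_space K q"
proof (cases p)
  case 0
  have "boundary_map K x b = 0" for b
    unfolding boundary_map_def
    by (intro sum.neutral ballI) (use assms 0 incD(3)[of _ b] in \<open>fastforce simp: chain_space_def\<close>)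
  then show ?thesis by (simp add: chain_space_def)
next
  case (Suc q)
  then show ?thesis using boundary_map_chain_space[OF K, of x q] assms by auto
qed

text \<open>The boundary of \<open>lift x\<close> has no lower cells and is itself a cycle, so
  \<open>lift_crit_part\<close> recovers it from its critical part.\<close>

lemma lift_boundary:
  assumes "x \<in> chain_space K' p"
  shows "boundary_map K (lift x) = lift (boundary_map K' x)"
proof -
  have x: "lift x \<in> chain_space K p" using assms by (rule lift_chain_space)
  then obtain q where "boundary_map K (lift x) \<in> chain_space K q"
    using chain_space_boundary_shift by blast
  then show ?thesis
    unfolding boundary_morse
    by (rule lift_crit_part) (simp_all add: boundary_lift[of x] boundary_boundary[OF K x])
qed

lemma boundary_morse_eq_zero:
  assumes "boundary_map K (lift x) = (\<lambda>_. 0)"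
  shows "boundary_map K' x = (\<lambda>_. 0)"
  using assms by (simp add: boundary_morse crit_part_def fun_eq_iff)

lemma lift_zero: "lift (\<lambda>_. 0) = (\<lambda>_. 0)"
  by (rule linear_op_zero[OF linear_op_lift])

lemma finite_chain_complex_morse: "finite_chain_complex K'"
  unfolding finite_chain_complex_def
proof (intro conjI allI impI ballI)
  show "finite (cells K')" by (simp add: morse_complex_def finite_C)
next
  fix A b assume "inc K' A b \<noteq> 0"
  then show "A \<in> cells K'" "b \<in> cells K'" "cell_dim K' A = cell_dim K' b + 1"
    by (auto simp: morse_complex_def split: if_splits)
next
  fix p x assume x: "x \<in> chain_space K' p"
  have "boundary_map K (lift (boundary_map K' x)) = (\<lambda>_. 0)"
    using lift_boundary[OF x] boundary_boundary[OF K lift_chain_space[OF x]] by simp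
  then show "boundary_map K' (boundary_map K' x) = (\<lambda>_. 0)"
    by (rule boundary_morse_eq_zero)
qed

text \<open>Surjectivity and injectivity on homology both follow from \<open>reduce\<close>, applied
  to a cycle of \<open>K\<close> and to a chain bounded by \<open>lift x\<close>,
  respectively.\<close>

lemma quasi_iso_lift: "quasi_iso lift K' K"
  unfolding quasi_iso_def
proof (intro conjI allI ballI)
  show "linear_op lift" by (rule linear_op_lift)
  fix p
  show "lift x \<in> cycles K p" if "x \<in> cycles K' p" for x
    using that lift_chain_space lift_boundary[of x p] lift_zero by (simp add: cycles_def)
  \<comment> \<open>The boundary of \<open>u\<close> is chosen to cancel the lower cells of
    \<open>y\<close>. Being a cycle, it does not change the boundary of \<open>y\<close>, so the
    difference is the lift of its critical part.\<close>
  have reduce: "\<exists>u\<in>chain_space K (q + 1). \<exists>x\<in>chain_space K' q.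
      lift x = (\<lambda>A. y A - boundary_map K u A)"
    if y: "y \<in> chain_space K q" and bd: "\<And>b. b \<in> snd ` M \<Longrightarrow> boundary_map K y b = 0" for y q
  proof -
    obtain u where u: "u \<in> chain_space K (q + 1)" "\<And>b. b \<in> snd ` M \<Longrightarrow> boundary_map K u b = y b"
      using upper_preimage[OF y] by blast
    let ?y = "\<lambda>A. y A - boundary_map K u A"
    have y': "?y \<in> chain_space K q"
      using y boundary_map_chain_space[OF K u(1)] linear_subspaceD(4)[OF linear_subspace_chain_space] by blast
    have "?y = lift (crit_part ?y)"
      using y' by (rule lift_crit_part)
        (simp_all add: u(2) bd linear_op_diff[OF linear_op_boundary_map] boundary_boundary[OF K u(1)])
    then show ?thesis using u(1) crit_part_chain_space[OF y'] by metis
  qed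
  show "\<exists>x\<in>cycles K' p. (\<lambda>A. z A - lift x A) \<in> boundaries K p" if z: "z \<in> cycles K p" for z
  proof -
    obtain u x where u: "u \<in> chain_space K (p + 1)" and x: "x \<in> chain_space K' p"
      and lx: "lift x = (\<lambda>A. z A - boundary_map K u A)"
      using reduce[of z p] z by (auto simp: cycles_def)
    have "boundary_map K (lift x) = (\<lambda>_. 0)"
      using z by (simp add: lx linear_op_diff[OF linear_op_boundary_map] cycles_def boundary_boundary[OF K u])
    then have "x \<in> cycles K' p" using x boundary_morse_eq_zero by (simp add: cycles_def)
    moreover have "(\<lambda>A. z A - lift x A) \<in> boundaries K p" using u by (simp add: lx boundaries_def)
    ultimately show ?thesis by blast
  qed
  show "lift x \<in> boundaries K p \<longleftrightarrow> x \<in> boundaries K' p" if x: "x \<in> cycles K' p" for x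
  proof
    assume "x \<in> boundaries K' p"
    then obtain y where y: "y \<in> chain_space K' (p + 1)" "x = boundary_map K' y"
      by (auto simp: boundaries_def)
    then show "lift x \<in> boundaries K p"
      unfolding boundaries_def y(2) lift_boundary[OF y(1), symmetric]
      by (intro imageI lift_chain_space)
  next
    assume "lift x \<in> boundaries K p"
    then obtain y where y: "y \<in> chain_space K (p + 1)" "lift x = boundary_map K y"
      by (auto simp: boundaries_def)
    \<comment> \<open>\<open>reduce\<close> applies to \<open>y\<close> because its boundary
      \<open>lift x\<close> contains no lower cell.\<close>
    then obtain u v where u: "u \<in> chain_space K (p + 1 + 1)" and v: "v \<in> chain_space K' (p + 1)"
      and lv: "lift v = (\<lambda>A. y A - boundary_map K u A)"
      using reduce[of y "p + 1"] lift_lower by metis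
    have "boundary_map K (lift v) = lift x"
      by (simp add: lv linear_op_diff[OF linear_op_boundary_map] y(2) boundary_boundary[OF K u])
    then have "boundary_map K' v = x"
      using crit_part_lift[of x p] x by (simp add: boundary_morse cycles_def)
    then show "x \<in> boundaries K' p" using v by (auto simp: boundaries_def)
  qed
qed

end

section \<open>Iterating a vital Morse construction\<close>

text \<open>The Morse graph has no edges, hence there are no paths and all incidences of the Morse
  complex are zero. Equality of the whole records makes the iteration literally constant.\<close>

lemma morse_complex_empty:
  assumes "finite_chain_complex K" "\<And>A b. inc K A b = 0"
  shows "morse_complex K {} = K"
  using assms by (cases K) (simp add: morse_complex_def critical_def morse_paths_def path_weight_def
     path_bot_def fun_eq_iff)

text \<open>A nonempty matching removes cells, so induction on their number applies to
  \<open>\<M> K\<close>; the map obtained there is composed with the lift of the first step.\<close>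

lemma vital_iterate:
  assumes "finite_chain_complex K" "vital_morse_construction \<M>"
  shows "\<exists>N G. finite_chain_complex ((\<M> ^^ N) K) \<and> quasi_iso G ((\<M> ^^ N) K) K \<and>
    (\<forall>A b. inc ((\<M> ^^ N) K) A b = 0)"
  using assms(1)
proof (induction "card (cells K)" arbitrary: K rule: less_induct)
  case less
  show ?case
  proof (cases "\<forall>A b. inc K A b = 0")
    case True
    then show ?thesis
      using less.prems quasi_iso_id by (intro exI[of _ 0]) auto
  next
    case False
    with assms(2) less.prems obtain M where acyc: "acyclic_matching K M" and ne: "M \<noteq> {}"
      and eq: "\<M> K = morse_complex K M"
      unfolding vital_morse_construction_def by blast
    interpret morse K M using less.prems acyc by unfold_locales
    have "cells (\<M> K) \<subset> cells K"
      using ne M_subset C_subset by (fastforce simp: eq morse_complex_def critical_def)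
    then have "card (cells (\<M> K)) < card (cells K)"
      using finite_cells by (rule psubset_card_mono[rotated])
    then obtain N F where "finite_chain_complex ((\<M> ^^ N) (\<M> K))"
      and F: "quasi_iso F ((\<M> ^^ N) (\<M> K)) (\<M> K)"
      and "\<forall>A b. inc ((\<M> ^^ N) (\<M> K)) A b = 0"
      using less.hyps[of "\<M> K"] finite_chain_complex_morse eq by auto
    moreover have "quasi_iso (\<lambda>x. lift (F x)) ((\<M> ^^ N) (\<M> K)) K"
      using F quasi_iso_lift finite_chain_complex_morse unfolding eq by (rule quasi_iso_comp)
    moreover have "(\<M> ^^ Suc N) K = (\<M> ^^ N) (\<M> K)" by (simp only: funpow_Suc_right o_apply)
    ultimately show ?thesis by metis
  qed
qed

lemma iterated_morse_complex_eq:
  assumes fcc: "finite_chain_complex ((\<M> ^^ N) K)" and inc0: "\<forall>A b. inc ((\<M> ^^ N) K) A b = 0"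
    and vital: "vital_morse_construction \<M>"
  shows "iterated_morse_complex \<M> K = (\<M> ^^ N) K"
proof -
  let ?L = "(\<M> ^^ N) K"
  obtain M where "acyclic_matching ?L M" "\<M> ?L = morse_complex ?L M"
    using vital fcc unfolding vital_morse_construction_def by blast
  \<comment> \<open>A matched pair would have nonzero incidence.\<close>
  moreover from this have "M = {}"
    using inc0 by (auto simp: acyclic_matching_def matching_def)
  ultimately have fixed: "\<M> ?L = ?L"
    using morse_complex_empty[OF fcc] inc0 by simp
  have stable: "(\<M> ^^ n) K = ?L" if "n \<ge> N" for n
    using that by (induction n rule: dec_induct) (simp_all add: fixed)
  show ?thesis
    unfolding iterated_morse_complex_def
  proof (rule the_equality)
    show "\<exists>m. \<forall>n\<ge>m. (\<M> ^^ n) K = ?L" using stable by blast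
    fix L assume "\<exists>m. \<forall>n\<ge>m. (\<M> ^^ n) K = L"
    then obtain m where "\<forall>n\<ge>m. (\<M> ^^ n) K = L" by blast
    \<comment> \<open>Both eventual values are attained at \<open>max m N\<close>.\<close>
    then show "L = ?L" using stable[of "max m N"] by (metis max.cobounded1 max.cobounded2)
  qed
qed

theorem lemma6p2:
  fixes K :: "('a, 'f::field) chain_complex"
    and \<M> :: "('a, 'f) chain_complex \<Rightarrow> ('a, 'f) chain_complex"
    and i :: nat
  assumes "finite_chain_complex K"
    and "vital_morse_construction \<M>"
  shows "betti K i =
    card {A \<in> cells (iterated_morse_complex \<M> K).
            cell_dim (iterated_morse_complex \<M> K) A = i}"
proof -
  obtain N G where "finite_chain_complex ((\<M> ^^ N) K)" and G: "quasi_iso G ((\<M> ^^ N) K) K"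
    and inc0: "\<forall>A b. inc ((\<M> ^^ N) K) A b = 0"
    using vital_iterate[OF assms] by blast
  moreover from this have "iterated_morse_complex \<M> K = (\<M> ^^ N) K"
    using assms(2) by (intro iterated_morse_complex_eq)
  ultimately show ?thesis
    using betti_eq_card_cells[OF G] by (simp add: finite_chain_complex_def)
qed

end
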